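(* Let $\varphi(z)=\frac{az+b}{cz+d}$ be a linear fractional self-map of $\mathbb{D}$ with $\|\varphi\|_\infty=\sup_{z\in\mathbb{D}}|\varphi(z)|<1$, and let $\sigma(z)=\frac{\overline{a}z-\overline{c}}{-\overline{b}z+\overline{d}}$ be its Krein adjoint. Consider $D_\varphi$ acting on $\widetilde{S}^2$. Then there is a finite rank operator $K_1$ on $\widetilde{S}^2$ such that $$D_\varphi^*\,T_z^*=T_z\,D_\sigma+K_1,$$ where adjoints are taken with respect to the inner product of $\widetilde{S}^2$ and $T_z$ denotes multiplication by the function $z$.
   Context: $\mathbb{D}$ is the open unit disk. $\widetilde{S}^2$ is the Hilbert space of analytic $f(z)=\sum_{n\ge0}a_nz^n$ on $\mathbb{D}$ with inner product $\langle f,g\rangle=a_0\overline{b_0}+a_1\overline{b_1}+\sum_{n\ge2}n(n-1)a_n\overline{b_n}$ for $g(z)=\sum b_nz^n$ (a weighted Hardy space with weights $\beta(0)=\beta(1)=1$, $\beta(n)=\sqrt{n(n-1)}$ for $n\ge2$; it has the same elements as $S^2$ with an equivalent norm). Its reproducing kernel is $K_w(z)=1+2\overline{w}z+(1-\overline{w}z)\log(1-\overline{w}z)$, and the kernel for evaluation of the derivative at $w$ is $K^{(1)}_w(z)=z-z\log(1-\overline{w}z)$. $D_\varphi f=f'\circ\varphi$; $T_\psi f=\psi f$ denotes multiplication by $\psi$. *)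

theory Defs
  imports "HOL-Analysis.Analysis"
begin

text \<open>Functions analytic on the unit disk are represented as functions complex \<Rightarrow> complex;
  only their values on the open unit disk matter. The n-th Taylor coefficient at 0:\<close>
definition tcoeff :: "(complex \<Rightarrow> complex) \<Rightarrow> nat \<Rightarrow> complex" where
  "tcoeff f n = (deriv ^^ n) f 0 / of_nat (fact n)"

definition wt2 :: "nat \<Rightarrow> real" where
  "wt2 n = (if n \<le> 1 then 1 else real n * (real n - 1))"

definition St2 :: "(complex \<Rightarrow> complex) set" where
  "St2 = {f. f holomorphic_on ball 0 1 \<and> summable (\<lambda>n. wt2 n * (cmod (tcoeff f n))\<^sup>2)}"

definition St2_inner :: "(complex \<Rightarrow> complex) \<Rightarrow> (complex \<Rightarrow> complex) \<Rightarrow> complex" where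
  "St2_inner f g = (\<Sum>n. of_real (wt2 n) * tcoeff f n * cnj (tcoeff g n))"

definition St2_norm :: "(complex \<Rightarrow> complex) \<Rightarrow> real" where
  "St2_norm f = sqrt (\<Sum>n. wt2 n * (cmod (tcoeff f n))\<^sup>2)"

text \<open>Equality of elements of S~^2 (= equality on the disk).\<close>
definition disk_eq :: "(complex \<Rightarrow> complex) \<Rightarrow> (complex \<Rightarrow> complex) \<Rightarrow> bool" where
  "disk_eq f g \<longleftrightarrow> (\<forall>z\<in>ball 0 1. f z = g z)"

definition Dop :: "(complex \<Rightarrow> complex) \<Rightarrow> (complex \<Rightarrow> complex) \<Rightarrow> (complex \<Rightarrow> complex)" where
  "Dop \<phi> f = (\<lambda>z. deriv f (\<phi> z))"

definition Tz :: "(complex \<Rightarrow> complex) \<Rightarrow> (complex \<Rightarrow> complex)" where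
  "Tz f = (\<lambda>z. z * f z)"

definition is_adjoint :: "((complex \<Rightarrow> complex) \<Rightarrow> (complex \<Rightarrow> complex))
     \<Rightarrow> ((complex \<Rightarrow> complex) \<Rightarrow> (complex \<Rightarrow> complex)) \<Rightarrow> bool" where
  "is_adjoint A B \<longleftrightarrow> (\<forall>g\<in>St2. B g \<in> St2) \<and>
     (\<forall>f\<in>St2. \<forall>g\<in>St2. St2_inner (A f) g = St2_inner f (B g))"

definition finite_rank_op :: "((complex \<Rightarrow> complex) \<Rightarrow> (complex \<Rightarrow> complex)) \<Rightarrow> bool" where
  "finite_rank_op K \<longleftrightarrow>
     (\<forall>f\<in>St2. K f \<in> St2) \<and>
     (\<forall>f\<in>St2. \<forall>g\<in>St2. \<forall>c::complex.
        disk_eq (K (\<lambda>z. c * f z + g z)) (\<lambda>z. c * K f z + K g z)) \<and>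
     (\<exists>C. \<forall>f\<in>St2. St2_norm (K f) \<le> C * St2_norm f) \<and>
     (\<exists>F. finite F \<and> F \<subseteq> St2 \<and>
        (\<forall>f\<in>St2. \<exists>c. disk_eq (K f) (\<lambda>z. \<Sum>h\<in>F. c h * h z)))"

end

theory Submission
  imports Defs "HOL-Complex_Analysis.Complex_Analysis"
begin

text \<open>
  Let \<open>K\<^sub>\<zeta>\<close> be the reproducing kernel of \<open>S~\<^sup>2\<close>. The value of \<open>D\<^sub>\<phi>\<^sup>* T\<^sub>z\<^sup>* f\<close> at \<open>\<zeta>\<close> is
  the pairing of \<open>f\<close> with \<open>T\<^sub>z D\<^sub>\<phi> K\<^sub>\<zeta>\<close>, which is the function
  \<open>w \<mapsto> cnj \<zeta> w (1 - Ln (1 - cnj \<zeta> \<phi>(w)))\<close>. The Krein adjoint satisfies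
  \<open>(c w + d) (1 - cnj \<zeta> \<phi>(w)) = (d - b cnj \<zeta>) (1 - cnj (\<sigma>(\<zeta>)) w)\<close>, so the logarithm splits as
  \<open>Ln (1 - cnj (\<sigma>(\<zeta>)) w) + Ln (1 - (b/d) cnj \<zeta>) - Ln (1 + (c/d) w)\<close>.
  Together with the constant 1, the first term reproduces \<open>\<zeta> f'(\<sigma>(\<zeta>))\<close>; the other two separate
  the variables \<open>\<zeta>\<close> and \<open>w\<close> and hence contribute an operator of rank at most 2. Since
  \<open>\<parallel>\<phi>\<parallel>\<^sub>\<infinity> < 1\<close>, \<open>\<phi>\<close> extends to a disk of radius greater than 1 with modulus bounded by some
  \<open>r < 1\<close>; the Cauchy estimates there justify every interchange of sums.
\<close>

section \<open>Interchange of double series\<close>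

text \<open>The product bound makes the family absolutely summable over pairs, so Fubini for
  unordered sums identifies both iterated sums with one total.\<close>

lemma dominated_double_sums:
  fixes f :: "nat \<Rightarrow> nat \<Rightarrow> complex" and u v :: "nat \<Rightarrow> real"
  assumes bound: "\<And>m k. cmod (f m k) \<le> u m * v k"
    and u: "summable u" "\<And>m. 0 \<le> u m" and v: "summable v" "\<And>k. 0 \<le> v k"
    and rows: "\<And>m. (\<lambda>k. f m k) sums s m" and cols: "\<And>k. (\<lambda>m. f m k) sums t k"
  obtains S where "s sums S" "t sums S"
proof -
  have uv: "(u has_sum suminf u) UNIV" "(v has_sum suminf v) UNIV"
    using u v by (auto intro!: norm_summable_imp_has_sum simp: summable_sums)
  have "(\<lambda>(m, k). u m * v k) summable_on UNIV \<times> UNIV"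
  proof (rule summable_on_SigmaI)
    show "((\<lambda>k. case (m, k) of (m, k) \<Rightarrow> u m * v k) has_sum u m * suminf v) UNIV" for m
      using has_sum_cmult_right[OF uv(2), of "u m"] by simp
    show "(\<lambda>m. u m * suminf v) summable_on UNIV"
      using has_sum_cmult_left[OF uv(1), of "suminf v"] by (auto simp: summable_on_def)
  qed (use u v in auto)
  then have "(\<lambda>p. norm (case p of (m, k) \<Rightarrow> f m k)) summable_on UNIV \<times> UNIV"
    by (rule Infinite_Sum.abs_summable_on_comparison_test') (auto simp: bound)
  then have "(\<lambda>(m, k). f m k) summable_on UNIV \<times> UNIV"
    by (rule abs_summable_summable)
  then obtain S where S: "((\<lambda>(m, k). f m k) has_sum S) (UNIV \<times> UNIV)"
    by (auto simp: summable_on_def)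
  have row: "((\<lambda>k. f m k) has_sum s m) UNIV" for m
    by (rule norm_summable_imp_has_sum[OF _ rows])
       (rule summable_comparison_test'[OF summable_mult[OF v(1), of "u m"]], simp add: bound)
  have col: "((\<lambda>m. f m k) has_sum t k) UNIV" for k
    by (rule norm_summable_imp_has_sum[OF _ cols])
       (rule summable_comparison_test'[OF summable_mult2[OF u(1), of "v k"]], simp add: bound)
  have "(s has_sum S) UNIV"
    by (rule has_sum_SigmaD[OF S]) (simp add: row)
  moreover have "(t has_sum S) UNIV"
    by (rule has_sum_SigmaD[OF has_sum_swap[THEN iffD1, OF S]]) (simp add: col)
  ultimately show thesis
    using that has_sum_imp_sums by blast
qed

section \<open>Taylor coefficients\<close>

lemma sums_tcoeff:
  assumes "f holomorphic_on ball 0 r" "cmod z < r"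
  shows "(\<lambda>n. tcoeff f n * z ^ n) sums f z"
  using holomorphic_power_series[OF assms(1), of z] assms(2) by (simp add: tcoeff_def)

text \<open>A series converging to \<open>f\<close> on the disk is its formal expansion at 0.
  Coefficients are computed below by exhibiting such a series.\<close>

lemma tcoeff_unique:
  assumes "\<And>z. cmod z < 1 \<Longrightarrow> (\<lambda>n. a n * z ^ n) sums f z"
  shows "tcoeff f = a" and "f holomorphic_on ball 0 1"
proof -
  show "f holomorphic_on ball 0 1"
    using assms by (intro power_series_holomorphic[where a = a]) auto
  have "eventually (\<lambda>u. (\<lambda>n. fps_nth (Abs_fps a) n * u ^ n) sums f u) (nhds 0)"
    using assms eventually_nhds_in_open[of "ball 0 1" "0::complex"]
    by (auto elim!: eventually_mono)
  from fps_nth_fps_expansion[OF has_fps_expansionI[OF this]] show "tcoeff f = a"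
    by (auto simp: tcoeff_def fun_eq_iff)
qed

text \<open>Purely formal, hence valid for arbitrary \<open>f\<close>: both sides unfold to the same
  iterated \<open>deriv\<close> at 0.\<close>

lemma tcoeff_deriv: "tcoeff (deriv f) n = of_nat (Suc n) * tcoeff f (Suc n)"
  by (simp add: tcoeff_def funpow_Suc_right del: funpow.simps of_nat_Suc fact_Suc)
     (simp add: field_simps del: of_nat_Suc)

lemma tcoeff_Cauchy_bound:
  assumes "f holomorphic_on cball 0 R" "0 < R" "\<And>z. cmod z \<le> R \<Longrightarrow> cmod (f z) \<le> B"
  shows "cmod (tcoeff f n) \<le> B * (1 / R) ^ n"
proof -
  have "cmod ((deriv ^^ n) f 0) \<le> fact n * B / R ^ n"
    by (rule Cauchy_inequality)
       (use assms in \<open>auto intro: holomorphic_on_subset holomorphic_on_imp_continuous_on\<close>)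
  then show ?thesis
    by (simp add: tcoeff_def norm_divide field_simps)
qed

section \<open>The weights and membership in \<open>St2\<close>\<close>

lemma wt2_ge_1: "1 \<le> wt2 n"
proof (cases "n \<le> 1")
  case False
  then have "1 * 1 \<le> real n * (real n - 1)"
    by (intro mult_mono) auto
  with False show ?thesis by (simp add: wt2_def)
qed (simp add: wt2_def)

lemma wt2_nonneg [simp]: "0 \<le> wt2 n"
  using wt2_ge_1[of n] by simp

lemma wt2_neq_0 [simp]: "wt2 n \<noteq> 0"
  using wt2_ge_1[of n] by auto

text \<open>The weight is at most \<open>(n + 1) * (n + 2)\<close>, the coefficient of the twice
  differentiated geometric series.\<close>

lemma summable_wt2_geometric:
  fixes x :: real
  assumes "0 \<le> x" "x < 1"
  shows "summable (\<lambda>n. wt2 n * x ^ n)"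
proof -
  have 1: "summable (\<lambda>n. diffs (\<lambda>_. 1) n * y ^ n)" if "norm y < 1" for y :: real
    by (rule termdiff_converges[where K = 1]) (use that in auto)
  have 2: "summable (\<lambda>n. diffs (diffs (\<lambda>_. 1)) n * x ^ n)"
    by (rule termdiff_converges[where K = 1]) (use assms 1 in auto)
  have "wt2 n \<le> diffs (diffs (\<lambda>_. 1)) n" for n
    by (auto simp: wt2_def diffs_def algebra_simps)
  then show ?thesis
    using assms by (intro summable_comparison_test'[OF 2]) (auto intro!: mult_right_mono)
qed

lemma summable_wt2_decay:
  fixes a :: "nat \<Rightarrow> complex"
  assumes "\<And>n. cmod (a n) \<le> C * q ^ n" "0 \<le> q" "q < 1"
  shows "summable (\<lambda>n. wt2 n * (cmod (a n))\<^sup>2)"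
proof -
  have "summable (\<lambda>n. C\<^sup>2 * (wt2 n * (q\<^sup>2) ^ n))"
    using assms by (intro summable_mult summable_wt2_geometric) (auto simp: power_less_one_iff)
  then show "summable (\<lambda>n. wt2 n * (cmod (a n))\<^sup>2)"
  proof (rule summable_comparison_test')
    fix n
    have "(cmod (a n))\<^sup>2 \<le> (C * q ^ n)\<^sup>2"
      using assms by (intro power_mono) auto
    then have "wt2 n * (cmod (a n))\<^sup>2 \<le> wt2 n * (C * q ^ n)\<^sup>2"
      by (intro mult_left_mono) auto
    then show "norm (wt2 n * (cmod (a n))\<^sup>2) \<le> C\<^sup>2 * (wt2 n * (q\<^sup>2) ^ n)"
      by (simp add: power_mult_distrib power_mult[symmetric] ac_simps)
  qed
qed

lemma summable_wt2_square_imp_bounded: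
  assumes "summable (\<lambda>n. wt2 n * (cmod (a n))\<^sup>2)"
  shows "cmod (a n) \<le> sqrt (\<Sum>n. wt2 n * (cmod (a n))\<^sup>2)"
proof -
  have "(cmod (a n))\<^sup>2 \<le> wt2 n * (cmod (a n))\<^sup>2"
    using mult_right_mono[OF wt2_ge_1, of "(cmod (a n))\<^sup>2"] by simp
  also have "\<dots> \<le> (\<Sum>n. wt2 n * (cmod (a n))\<^sup>2)"
    using sum_le_suminf[OF assms, of "{n}"] by simp
  finally show ?thesis
    by (rule real_le_rsqrt)
qed

text \<open>Weights of at least 1 bound the coefficients, so the series converges on the disk. Both
  adjoints are constructed from their coefficients in this way.\<close>

lemma St2_power_series:
  assumes "summable (\<lambda>n. wt2 n * (cmod (a n))\<^sup>2)"
  shows "(\<lambda>z. \<Sum>n. a n * z ^ n) \<in> St2" and "tcoeff (\<lambda>z. \<Sum>n. a n * z ^ n) = a"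
proof -
  have *: "(\<lambda>n. a n * z ^ n) sums (\<Sum>n. a n * z ^ n)" if "cmod z < 1" for z
  proof (rule summable_sums, rule summable_comparison_test')
    let ?C = "sqrt (\<Sum>n. wt2 n * (cmod (a n))\<^sup>2)"
    show "summable (\<lambda>n. ?C * cmod z ^ n)"
      using that by (intro summable_mult) auto
    show "norm (a n * z ^ n) \<le> ?C * cmod z ^ n" for n
      using summable_wt2_square_imp_bounded[OF assms, of n]
      by (simp add: norm_mult norm_power mult_right_mono)
  qed
  show "tcoeff (\<lambda>z. \<Sum>n. a n * z ^ n) = a"
    by (rule tcoeff_unique(1)) (rule *)
  moreover have "(\<lambda>z. \<Sum>n. a n * z ^ n) holomorphic_on ball 0 1"
    by (rule tcoeff_unique(2)) (rule *)
  ultimately show "(\<lambda>z. \<Sum>n. a n * z ^ n) \<in> St2"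
    using assms by (simp add: St2_def)
qed

lemma holomorphic_cball_imp_tcoeff_decay:
  assumes "f holomorphic_on cball 0 R" "1 < R"
  obtains B where "\<And>n. cmod (tcoeff f n) \<le> B * (1 / R) ^ n"
proof -
  have "bounded (f ` cball 0 R)"
    using assms by (intro compact_imp_bounded compact_continuous_image)
      (auto intro: holomorphic_on_imp_continuous_on)
  then obtain B where "\<And>z. cmod z \<le> R \<Longrightarrow> cmod (f z) \<le> B"
    unfolding bounded_iff by (metis imageI mem_cball_0)
  with assms tcoeff_Cauchy_bound[of f R B] that show thesis by auto
qed

text \<open>Cauchy estimates on a disk of radius greater than 1 give geometric decay, which beats
  the quadratic weights. Membership of the concrete functions below is checked through this
  criterion.\<close>

lemma holomorphic_cball_imp_St2:
  assumes "f holomorphic_on cball 0 R" "1 < R"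
  shows "f \<in> St2"
proof -
  obtain B where "\<And>n. cmod (tcoeff f n) \<le> B * (1 / R) ^ n"
    using holomorphic_cball_imp_tcoeff_decay[OF assms] by blast
  from summable_wt2_decay[OF this] assms show ?thesis
    by (auto simp: St2_def intro: holomorphic_on_subset)
qed

lemma St2_holomorphic: "f \<in> St2 \<Longrightarrow> f holomorphic_on ball 0 1"
  by (simp add: St2_def)

lemma St2_tcoeff_le_norm: "f \<in> St2 \<Longrightarrow> cmod (tcoeff f n) \<le> St2_norm f"
  unfolding St2_norm_def by (rule summable_wt2_square_imp_bounded) (simp add: St2_def)

lemma St2_norm_nonneg: "f \<in> St2 \<Longrightarrow> 0 \<le> St2_norm f"
  using St2_tcoeff_le_norm[of f 0] norm_ge_zero order_trans by blast

lemma St2_inner_sums: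
  assumes "f \<in> St2" "g \<in> St2"
  shows "(\<lambda>n. of_real (wt2 n) * tcoeff f n * cnj (tcoeff g n)) sums St2_inner f g"
  unfolding St2_inner_def
proof (rule summable_sums, rule summable_comparison_test')
  show "summable (\<lambda>n. wt2 n * (cmod (tcoeff f n))\<^sup>2 + wt2 n * (cmod (tcoeff g n))\<^sup>2)"
    using assms by (intro summable_add) (auto simp: St2_def)
  fix n
  let ?x = "cmod (tcoeff f n)" and ?y = "cmod (tcoeff g n)"
  have "?x * ?y \<le> ?x\<^sup>2 + ?y\<^sup>2"
    using sum_squares_bound[of ?x ?y] mult_nonneg_nonneg[of ?x ?y]
    by (simp add: mult.assoc del: mult_nonneg_nonneg)
  then have "wt2 n * (?x * ?y) \<le> wt2 n * (?x\<^sup>2 + ?y\<^sup>2)"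
    by (rule mult_left_mono) simp
  then show "norm (of_real (wt2 n) * tcoeff f n * cnj (tcoeff g n)) \<le> wt2 n * ?x\<^sup>2 + wt2 n * ?y\<^sup>2"
    by (simp add: norm_mult algebra_simps)
qed

section \<open>Composition with a symbol of modulus at most \<open>r < 1\<close> on a larger
  disk\<close>

text \<open>Isolates what the study of \<open>Dop \<phi>\<close> and its adjoint uses; the linear
  fractional form enters only later.\<close>

locale contractive_symbol =
  fixes \<phi> :: "complex \<Rightarrow> complex" and R r :: real
  assumes R: "1 < R" and hol: "\<phi> holomorphic_on cball 0 R"
    and bound: "\<And>z. cmod z \<le> R \<Longrightarrow> cmod (\<phi> z) \<le> r" and r: "0 < r" "r < 1"
begin

text \<open>The decay in \<open>m\<close> comes from the bound on \<phi>, that in \<open>k\<close>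
  from the radius; the product form is what \<open>dominated_double_sums\<close> requires.\<close>

lemma power_tcoeff_bound: "cmod (tcoeff (\<lambda>z. \<phi> z ^ m) k) \<le> r ^ m * (1 / R) ^ k"
  by (rule tcoeff_Cauchy_bound)
     (use hol R bound in \<open>auto intro!: holomorphic_intros power_mono simp: norm_power\<close>)

lemma comp_holomorphic:
  assumes "F holomorphic_on ball 0 1"
  shows "(\<lambda>z. F (\<phi> z)) holomorphic_on cball 0 R"
  using holomorphic_on_compose_gen[OF hol assms] bound r by (fastforce simp: o_def)

lemma power_St2: "(\<lambda>z. \<phi> z ^ m) \<in> St2"
  using R hol by (intro holomorphic_cball_imp_St2) (auto intro: holomorphic_intros)

lemma summable_tcoeff_r:
  assumes "F holomorphic_on ball 0 1"
  shows "summable (\<lambda>m. cmod (tcoeff F m) * r ^ m)"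
proof -
  \<comment> \<open>Convergence at a point of modulus \<open>q > r\<close> forces absolute
    convergence at \<open>r\<close>.\<close>
  obtain q where q: "r < q" "q < 1"
    using r(2) dense by blast
  have "summable (\<lambda>m. tcoeff F m * complex_of_real q ^ m)"
    using sums_tcoeff[OF assms, of "of_real q"] q r by (auto simp: sums_iff)
  from powser_insidea[OF this, of "of_real r"] show ?thesis
    using q r by (simp add: norm_mult norm_power)
qed

lemma tcoeff_comp_sums:
  assumes F: "F holomorphic_on ball 0 1"
  shows "(\<lambda>m. tcoeff F m * tcoeff (\<lambda>z. \<phi> z ^ m) k) sums tcoeff (\<lambda>z. F (\<phi> z)) k"
proof -
  define c where "c = (\<lambda>m. tcoeff (\<lambda>z. \<phi> z ^ m))"
  have c: "cmod (c m k) \<le> r ^ m * (1 / R) ^ k" for m k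
    unfolding c_def by (rule power_tcoeff_bound)
  have sm: "summable (\<lambda>m. tcoeff F m * c m k)" for k
    by (rule summable_comparison_test'[OF summable_mult2[OF summable_tcoeff_r[OF F], of "(1 / R) ^ k"]])
       (use c in \<open>simp add: norm_mult mult_left_mono mult.assoc\<close>)
  have "(\<lambda>k. (\<Sum>m. tcoeff F m * c m k) * w ^ k) sums F (\<phi> w)" if w: "cmod w < 1" for w
  proof -
    have \<phi>w: "cmod (\<phi> w) < 1"
      using bound[of w] w R r by simp
    obtain S where S: "(\<lambda>m. tcoeff F m * \<phi> w ^ m) sums S"
      "(\<lambda>k. (\<Sum>m. tcoeff F m * c m k) * w ^ k) sums S"
    proof (rule dominated_double_sums)
      show "cmod (tcoeff F m * c m k * w ^ k) \<le> (cmod (tcoeff F m) * r ^ m) * (1 / R) ^ k" for m k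
      proof -
        have "cmod (c m k) * cmod w ^ k \<le> (r ^ m * (1 / R) ^ k) * 1"
          using w r R by (intro mult_mono c power_le_one) auto
        then show ?thesis
          by (simp add: norm_mult norm_power mult_left_mono mult.assoc)
      qed
      show "summable (\<lambda>m. cmod (tcoeff F m) * r ^ m)"
        by (rule summable_tcoeff_r[OF F])
      show "summable (\<lambda>k. (1 / R) ^ k)"
        using R by (intro summable_geometric) auto
      show "(\<lambda>k. tcoeff F m * c m k * w ^ k) sums (tcoeff F m * \<phi> w ^ m)" for m
        using sums_mult[OF sums_tcoeff[of "\<lambda>z. \<phi> z ^ m" 1 w], of "tcoeff F m"]
          power_St2[of m] w by (simp add: St2_def c_def mult.assoc)
      show "(\<lambda>m. tcoeff F m * c m k * w ^ k) sums ((\<Sum>m. tcoeff F m * c m k) * w ^ k)" for k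
        by (intro sums_mult2 summable_sums sm)
    qed (use r R in auto)
    then show ?thesis
      using sums_tcoeff[OF F \<phi>w] sums_unique2 by blast
  qed
  from tcoeff_unique(1)[OF this] show ?thesis
    using summable_sums[OF sm, of k] by (simp add: c_def)
qed

text \<open>Reduces pairings with a composition to pairings with powers of \<phi>. It is applied to
  \<open>F = deriv f\<close> for the adjoint identity and to
  \<open>F u = 1 - Ln (1 - cnj \<zeta> * u)\<close> for evaluation at \<zeta>.\<close>

lemma inner_comp_sums:
  assumes F: "F holomorphic_on ball 0 1" and g: "g \<in> St2"
  shows "(\<lambda>m. tcoeff F m * St2_inner (\<lambda>z. \<phi> z ^ m) g) sums St2_inner (\<lambda>z. F (\<phi> z)) g"
proof -
  define c where "c = (\<lambda>m. tcoeff (\<lambda>z. \<phi> z ^ m))"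
  define f where "f = (\<lambda>m k. tcoeff F m * (of_real (wt2 k) * c m k * cnj (tcoeff g k)))"
  have F\<phi>: "(\<lambda>z. F (\<phi> z)) \<in> St2"
    using comp_holomorphic[OF F] R by (rule holomorphic_cball_imp_St2)
  obtain S where S: "(\<lambda>m. tcoeff F m * St2_inner (\<lambda>z. \<phi> z ^ m) g) sums S"
    "(\<lambda>k. of_real (wt2 k) * tcoeff (\<lambda>z. F (\<phi> z)) k * cnj (tcoeff g k)) sums S"
  proof (rule dominated_double_sums)
    show "cmod (f m k) \<le> (cmod (tcoeff F m) * r ^ m) * (wt2 k * (1 / R) ^ k * St2_norm g)" for m k
    proof -
      have "cmod (c m k) * cmod (tcoeff g k) \<le> (r ^ m * (1 / R) ^ k) * St2_norm g"
        unfolding c_def using R r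
        by (intro mult_mono power_tcoeff_bound St2_tcoeff_le_norm g) auto
      then have "cmod (tcoeff F m) * (wt2 k * (cmod (c m k) * cmod (tcoeff g k)))
          \<le> cmod (tcoeff F m) * (wt2 k * ((r ^ m * (1 / R) ^ k) * St2_norm g))"
        by (intro mult_left_mono) auto
      then show ?thesis
        by (simp add: f_def norm_mult mult.assoc mult.left_commute)
    qed
    show "summable (\<lambda>m. cmod (tcoeff F m) * r ^ m)"
      by (rule summable_tcoeff_r[OF F])
    show "summable (\<lambda>k. wt2 k * (1 / R) ^ k * St2_norm g)"
      using R by (intro summable_mult2 summable_wt2_geometric) auto
    show "f m sums (tcoeff F m * St2_inner (\<lambda>z. \<phi> z ^ m) g)" for m
      unfolding f_def c_def by (intro sums_mult St2_inner_sums power_St2 g)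
    show "(\<lambda>m. f m k) sums (of_real (wt2 k) * tcoeff (\<lambda>z. F (\<phi> z)) k * cnj (tcoeff g k))" for k
      using sums_mult2[OF tcoeff_comp_sums[OF F], of k "of_real (wt2 k) * cnj (tcoeff g k)"]
      by (simp add: f_def c_def ac_simps)
  qed (use r R St2_norm_nonneg[OF g] in auto)
  then show ?thesis
    using St2_inner_sums[OF F\<phi> g] sums_unique2 by blast
qed

end

section \<open>Bounded functionals, linear structure, and operators of rank at most 2\<close>

text \<open>Each coefficient of \<open>g\<close> is at most its norm, so geometric decay of
  \<open>h\<close> bounds the pairing, with a constant linear in \<open>B\<close>. This yields the
  decay of the coefficients of \<open>Dop_adjoint g\<close> and the boundedness of a functional in
  the finite rank operator.\<close>

lemma St2_inner_bound:
  assumes decay: "\<And>k. cmod (tcoeff h k) \<le> B * q ^ k" and q: "0 \<le> q" "q < 1" and g: "g \<in> St2"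
  shows "cmod (St2_inner h g) \<le> B * (\<Sum>k. wt2 k * q ^ k) * St2_norm g"
proof -
  have sm: "summable (\<lambda>k. wt2 k * q ^ k)"
    by (rule summable_wt2_geometric[OF q])
  have "cmod (St2_inner h g) \<le> (\<Sum>k. (B * St2_norm g) * (wt2 k * q ^ k))"
    unfolding St2_inner_def
  proof (rule norm_suminf_le)
    fix k
    have "cmod (tcoeff h k) * cmod (tcoeff g k) \<le> (B * q ^ k) * St2_norm g"
      using order_trans[OF norm_ge_zero decay]
      by (intro mult_mono decay St2_tcoeff_le_norm g) auto
    then have "wt2 k * (cmod (tcoeff h k) * cmod (tcoeff g k)) \<le> wt2 k * ((B * q ^ k) * St2_norm g)"
      by (rule mult_left_mono) simp
    then show "cmod (of_real (wt2 k) * tcoeff h k * cnj (tcoeff g k))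
        \<le> (B * St2_norm g) * (wt2 k * q ^ k)"
      by (simp add: norm_mult ac_simps)
  qed (intro summable_mult sm)
  also have "\<dots> = B * (\<Sum>k. wt2 k * q ^ k) * St2_norm g"
    by (subst suminf_mult[OF sm]) simp
  finally show ?thesis .
qed

lemma tcoeff_cong:
  assumes "f holomorphic_on ball 0 1" "\<And>z. cmod z < 1 \<Longrightarrow> g z = f z"
  shows "tcoeff g = tcoeff f"
  by (rule tcoeff_unique(1)) (use assms sums_tcoeff[OF assms(1)] in simp)

lemma tcoeff_linear:
  assumes "f holomorphic_on ball 0 1" "g holomorphic_on ball 0 1"
  shows "tcoeff (\<lambda>z. c * f z + g z) = (\<lambda>n. c * tcoeff f n + tcoeff g n)"
proof (rule tcoeff_unique(1))
  fix z :: complex assume z: "cmod z < 1"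
  show "(\<lambda>n. (c * tcoeff f n + tcoeff g n) * z ^ n) sums (c * f z + g z)"
    using sums_add[OF sums_mult[OF sums_tcoeff[OF assms(1) z], of c] sums_tcoeff[OF assms(2) z]]
    by (simp add: algebra_simps)
qed

lemma cmod_add_square_le: "(cmod (x + y))\<^sup>2 \<le> 2 * (cmod x)\<^sup>2 + 2 * (cmod y)\<^sup>2"
proof -
  have "(cmod (x + y))\<^sup>2 \<le> (cmod x + cmod y)\<^sup>2"
    by (intro power_mono norm_triangle_ineq) auto
  also have "\<dots> \<le> 2 * (cmod x)\<^sup>2 + 2 * (cmod y)\<^sup>2"
    using sum_squares_bound[of "cmod x" "cmod y"] by (simp add: power2_sum)
  finally show ?thesis .
qed

text \<open>The crude factor 2 stems from \<open>cmod_add_square_le\<close>; it is harmless because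
  only boundedness of an operator is derived from it.\<close>

lemma St2_linear_combination:
  assumes u: "u \<in> St2" and v: "v \<in> St2"
  shows "(\<lambda>z. \<alpha> * u z + \<beta> * v z) \<in> St2"
    and "St2_norm (\<lambda>z. \<alpha> * u z + \<beta> * v z) \<le> 2 * (cmod \<alpha> * St2_norm u + cmod \<beta> * St2_norm v)"
proof -
  let ?h = "\<lambda>z. \<alpha> * u z + \<beta> * v z"
  have hol: "u holomorphic_on ball 0 1" "v holomorphic_on ball 0 1"
    using u v by (simp_all add: St2_def)
  have "tcoeff (\<lambda>z. \<beta> * v z) = (\<lambda>n. \<beta> * tcoeff v n)"
    using tcoeff_linear[OF hol(2), of "\<lambda>_. 0" \<beta>] by (simp add: tcoeff_def)
  then have tc: "tcoeff ?h = (\<lambda>n. \<alpha> * tcoeff u n + \<beta> * tcoeff v n)"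
    using tcoeff_linear[OF hol(1), of "\<lambda>z. \<beta> * v z" \<alpha>] hol
    by (simp add: holomorphic_intros)
  let ?su = "\<lambda>n. wt2 n * (cmod (tcoeff u n))\<^sup>2" and ?sv = "\<lambda>n. wt2 n * (cmod (tcoeff v n))\<^sup>2"
  let ?b = "\<lambda>n. 2 * (cmod \<alpha>)\<^sup>2 * ?su n + 2 * (cmod \<beta>)\<^sup>2 * ?sv n"
  have sm: "summable ?su" "summable ?sv"
    using u v by (simp_all add: St2_def)
  have smb: "summable ?b"
    by (intro summable_add summable_mult sm)
  have le: "wt2 n * (cmod (tcoeff ?h n))\<^sup>2 \<le> ?b n" for n
    using mult_left_mono[OF cmod_add_square_le wt2_nonneg, of n "\<alpha> * tcoeff u n" "\<beta> * tcoeff v n"]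
    by (simp add: tc norm_mult power_mult_distrib algebra_simps)
  have smh: "summable (\<lambda>n. wt2 n * (cmod (tcoeff ?h n))\<^sup>2)"
    by (rule summable_comparison_test'[OF smb]) (use le in simp)
  then show "?h \<in> St2"
    using hol by (simp add: St2_def holomorphic_intros)
  have sq: "suminf ?su = (St2_norm u)\<^sup>2" "suminf ?sv = (St2_norm v)\<^sup>2"
    using sm by (simp_all add: St2_norm_def suminf_nonneg)
  have "(\<Sum>n. wt2 n * (cmod (tcoeff ?h n))\<^sup>2) \<le> suminf ?b"
    by (rule suminf_le[OF le smh smb])
  also have "\<dots> = 2 * (cmod \<alpha>)\<^sup>2 * suminf ?su + 2 * (cmod \<beta>)\<^sup>2 * suminf ?sv"
    using sums_unique[OF sums_add[OF sums_mult[OF summable_sums[OF sm(1)]] sums_mult[OF summable_sums[OF sm(2)]]]]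
    by metis
  also have "\<dots> = 2 * (cmod \<alpha> * St2_norm u)\<^sup>2 + 2 * (cmod \<beta> * St2_norm v)\<^sup>2"
    by (simp only: sq power_mult_distrib mult.assoc)
  also have "\<dots> \<le> (2 * (cmod \<alpha> * St2_norm u + cmod \<beta> * St2_norm v))\<^sup>2"
  proof -
    have "0 \<le> (cmod \<alpha> * St2_norm u) * (cmod \<beta> * St2_norm v)"
      using St2_norm_nonneg u v by simp
    then show ?thesis
      using zero_le_power2[of "cmod \<alpha> * St2_norm u"] zero_le_power2[of "cmod \<beta> * St2_norm v"]
      unfolding power_mult_distrib[of 2] power2_sum mult.assoc by simp
  qed
  finally show "St2_norm ?h \<le> 2 * (cmod \<alpha> * St2_norm u + cmod \<beta> * St2_norm v)"
    using St2_norm_nonneg u v unfolding St2_norm_def[of ?h] by (intro real_le_lsqrt) auto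
qed

lemma St2_linear:
  assumes "f \<in> St2" "g \<in> St2"
  shows "(\<lambda>z. c * f z + g z) \<in> St2"
  using St2_linear_combination(1)[OF assms, of c 1] by simp

lemma St2_inner_linear_left:
  assumes "f \<in> St2" "g \<in> St2" "h \<in> St2"
  shows "St2_inner (\<lambda>z. c * f z + g z) h = c * St2_inner f h + St2_inner g h"
proof -
  have "(\<lambda>n. of_real (wt2 n) * tcoeff (\<lambda>z. c * f z + g z) n * cnj (tcoeff h n)) sums
      (c * St2_inner f h + St2_inner g h)"
    using sums_add[OF sums_mult[OF St2_inner_sums[OF assms(1,3)], of c] St2_inner_sums[OF assms(2,3)]]
    unfolding tcoeff_linear[OF assms(1,2)[THEN St2_holomorphic]] by (simp add: algebra_simps)
  then show ?thesis
    by (simp add: St2_inner_def sums_iff)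
qed

lemma St2_inner_cnj:
  assumes "f \<in> St2" "g \<in> St2"
  shows "cnj (St2_inner f g) = St2_inner g f"
  using sums_cnj[THEN iffD2, OF St2_inner_sums[OF assms]] St2_inner_sums[OF assms(2,1)]
  by (intro sums_unique2[where f = "\<lambda>n. of_real (wt2 n) * tcoeff g n * cnj (tcoeff f n)"])
     (auto simp: ac_simps)

lemma finite_rank_op_rank_2:
  assumes u: "u \<in> St2" and v: "v \<in> St2"
    and lin: "\<And>f g c. f \<in> St2 \<Longrightarrow> g \<in> St2 \<Longrightarrow> \<alpha> (\<lambda>z. c * f z + g z) = c * \<alpha> f + \<alpha> g"
      "\<And>f g c. f \<in> St2 \<Longrightarrow> g \<in> St2 \<Longrightarrow> \<beta> (\<lambda>z. c * f z + g z) = c * \<beta> f + \<beta> g"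
    and bdd: "\<And>f. f \<in> St2 \<Longrightarrow> cmod (\<alpha> f) \<le> A * St2_norm f"
      "\<And>f. f \<in> St2 \<Longrightarrow> cmod (\<beta> f) \<le> B * St2_norm f"
  shows "finite_rank_op (\<lambda>f z. \<alpha> f * u z + \<beta> f * v z)"
  unfolding finite_rank_op_def
proof (intro conjI ballI allI)
  fix f assume f: "f \<in> St2"
  show "(\<lambda>z. \<alpha> f * u z + \<beta> f * v z) \<in> St2"
    by (rule St2_linear_combination(1)[OF u v])
next
  fix f g c assume fg: "f \<in> St2" "g \<in> St2"
  show "disk_eq (\<lambda>z. \<alpha> (\<lambda>z. c * f z + g z) * u z + \<beta> (\<lambda>z. c * f z + g z) * v z)
      (\<lambda>z. c * (\<alpha> f * u z + \<beta> f * v z) + (\<alpha> g * u z + \<beta> g * v z))"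
    unfolding disk_eq_def lin(1)[OF fg] lin(2)[OF fg] by (simp add: algebra_simps)
next
  have "St2_norm (\<lambda>z. \<alpha> f * u z + \<beta> f * v z) \<le> (2 * (A * St2_norm u + B * St2_norm v)) * St2_norm f"
    if f: "f \<in> St2" for f
  proof -
    have "cmod (\<alpha> f) * St2_norm u \<le> (A * St2_norm f) * St2_norm u"
      "cmod (\<beta> f) * St2_norm v \<le> (B * St2_norm f) * St2_norm v"
      using bdd[OF f] u v by (simp_all add: mult_right_mono St2_norm_nonneg)
    with St2_linear_combination(2)[OF u v, of "\<alpha> f" "\<beta> f"] show ?thesis
      by (simp add: algebra_simps)
  qed
  then show "\<exists>C. \<forall>f\<in>St2. St2_norm (\<lambda>z. \<alpha> f * u z + \<beta> f * v z) \<le> C * St2_norm f"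
    by blast
next
  have "\<exists>c. disk_eq (\<lambda>z. \<alpha> f * u z + \<beta> f * v z) (\<lambda>z. \<Sum>h\<in>{u, v}. c h * h z)" for f
  \<comment> \<open>If \<open>u = v\<close>, the set \<open>{u, v}\<close> is a singleton and the
    two coefficients must be added.\<close>
  proof (cases "u = v")
    case True
    then show ?thesis
      by (intro exI[of _ "\<lambda>_. \<alpha> f + \<beta> f"]) (simp add: disk_eq_def algebra_simps)
  next
    case False
    then show ?thesis
      by (intro exI[of _ "\<lambda>h. if h = u then \<alpha> f else \<beta> f"]) (auto simp: disk_eq_def)
  qed
  then show "\<exists>F. finite F \<and> F \<subseteq> St2 \<and>
      (\<forall>f\<in>St2. \<exists>c. disk_eq (\<lambda>z. \<alpha> f * u z + \<beta> f * v z) (\<lambda>z. \<Sum>h\<in>F. c h * h z))"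
    using u v by (intro exI[of _ "{u, v}"]) auto
qed

section \<open>The adjoint of multiplication by z\<close>

text \<open>A weighted backward shift, forced by pairing \<open>Tz\<close> of a monomial
  \<open>z ^ n\<close> with \<open>g\<close>.\<close>

definition Tz_adjoint :: "(complex \<Rightarrow> complex) \<Rightarrow> complex \<Rightarrow> complex" where
  "Tz_adjoint g = (\<lambda>z. \<Sum>n. of_real (wt2 (Suc n) / wt2 n) * tcoeff g (Suc n) * z ^ n)"

text \<open>For \<open>n \<ge> 2\<close> the ratio is \<open>(n + 1) / (n - 1)\<close>, which is
  largest at \<open>n = 2\<close>, with value 3. The bound keeps the backward shift inside
  \<open>St2\<close>.\<close>

lemma wt2_Suc_le: "wt2 (Suc n) \<le> 3 * wt2 n"
proof (cases "n \<le> 1")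
  case False
  then have "real n * (real n + 1) \<le> real n * (3 * (real n - 1))"
    by (intro mult_left_mono) auto
  with False show ?thesis
    by (simp add: wt2_def algebra_simps)
qed (auto simp: wt2_def le_Suc_eq)

lemma Tz_adjoint_St2:
  assumes "g \<in> St2"
  shows "Tz_adjoint g \<in> St2"
    and "tcoeff (Tz_adjoint g) = (\<lambda>n. of_real (wt2 (Suc n) / wt2 n) * tcoeff g (Suc n))"
proof -
  have "summable (\<lambda>n. wt2 n * (cmod (of_real (wt2 (Suc n) / wt2 n) * tcoeff g (Suc n)))\<^sup>2)"
  proof (rule summable_comparison_test')
    show "summable (\<lambda>n. 3 * (wt2 (Suc n) * (cmod (tcoeff g (Suc n)))\<^sup>2))"
      using assms summable_Suc_iff[of "\<lambda>n. wt2 n * (cmod (tcoeff g n))\<^sup>2"]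
      by (intro summable_mult) (simp add: St2_def)
    fix n
    have "wt2 n * (wt2 (Suc n) / wt2 n)\<^sup>2 = wt2 (Suc n) * (wt2 (Suc n) / wt2 n)"
      by (simp add: power2_eq_square)
    also have "\<dots> \<le> wt2 (Suc n) * 3"
      using wt2_Suc_le[of n] wt2_ge_1[of n] by (intro mult_left_mono) (auto simp: field_simps)
    finally have "wt2 n * (wt2 (Suc n) / wt2 n)\<^sup>2 * (cmod (tcoeff g (Suc n)))\<^sup>2
        \<le> wt2 (Suc n) * 3 * (cmod (tcoeff g (Suc n)))\<^sup>2"
      by (rule mult_right_mono) simp
    then show "norm (wt2 n * (cmod (of_real (wt2 (Suc n) / wt2 n) * tcoeff g (Suc n)))\<^sup>2)
        \<le> 3 * (wt2 (Suc n) * (cmod (tcoeff g (Suc n)))\<^sup>2)"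
      by (simp add: norm_mult norm_divide power_mult_distrib power_divide mult.assoc)
  qed
  from St2_power_series[OF this] show "Tz_adjoint g \<in> St2"
    and "tcoeff (Tz_adjoint g) = (\<lambda>n. of_real (wt2 (Suc n) / wt2 n) * tcoeff g (Suc n))"
    by (simp_all add: Tz_adjoint_def)
qed

lemma tcoeff_Tz:
  assumes "f holomorphic_on ball 0 1"
  shows "tcoeff (Tz f) = (\<lambda>n. case n of 0 \<Rightarrow> 0 | Suc m \<Rightarrow> tcoeff f m)"
proof (rule tcoeff_unique(1))
  fix z :: complex assume z: "cmod z < 1"
  have "(\<lambda>n. (case Suc n of 0 \<Rightarrow> 0 | Suc m \<Rightarrow> tcoeff f m) * z ^ Suc n) sums (z * f z)"
    using sums_mult[OF sums_tcoeff[OF assms z], of z] by (simp add: ac_simps)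
  from sums_Suc[OF this]
  show "(\<lambda>n. (case n of 0 \<Rightarrow> 0 | Suc m \<Rightarrow> tcoeff f m) * z ^ n) sums Tz f z"
    by (simp add: Tz_def)
qed

lemma is_adjoint_Tz: "is_adjoint Tz Tz_adjoint"
  unfolding is_adjoint_def
proof (intro conjI ballI)
  fix f g assume f: "f \<in> St2" and g: "g \<in> St2"
  have "(\<lambda>n. of_real (wt2 (Suc n)) * tcoeff (Tz f) (Suc n) * cnj (tcoeff g (Suc n)))
      sums St2_inner f (Tz_adjoint g)"
    using St2_inner_sums[OF f Tz_adjoint_St2(1)[OF g]]
    by (simp add: Tz_adjoint_St2(2)[OF g] tcoeff_Tz[OF St2_holomorphic[OF f]] ac_simps)
  \<comment> \<open>The term of index 0 is zero because \<open>Tz f\<close> vanishes at 0.\<close>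
  from sums_Suc[OF this] show "St2_inner (Tz f) g = St2_inner f (Tz_adjoint g)"
    by (simp add: St2_inner_def sums_iff tcoeff_Tz[OF St2_holomorphic[OF f]])
qed (rule Tz_adjoint_St2(1))

section \<open>Logarithms and the kernel of derivative evaluation\<close>

lemma cmod_mult_less_1: "cmod x < 1 \<Longrightarrow> cmod y < 1 \<Longrightarrow> cmod (x * y) < 1"
  using mult_strict_mono'[of "cmod x" 1 "cmod y" 1] by (simp add: norm_mult)

lemma Re_one_minus_pos: "cmod x < 1 \<Longrightarrow> 0 < Re (1 - x)"
  using complex_Re_le_cmod[of x] by simp

lemma one_minus_notin_nonpos_Reals: "cmod x < 1 \<Longrightarrow> 1 - x \<notin> \<real>\<^sub>\<le>\<^sub>0"
  using Re_one_minus_pos[of x] by (auto simp: complex_nonpos_Reals_iff)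

lemma Ln_one_minus_sums: "cmod x < 1 \<Longrightarrow> (\<lambda>n. - (x ^ n) / of_nat n) sums Ln (1 - x)"
  using Ln_series'[of "- x"] by simp

text \<open>The kernel for evaluation of the derivative at \<open>s\<close> is the identity minus
  \<open>zLn (cnj s)\<close>.\<close>

definition zLn :: "complex \<Rightarrow> complex \<Rightarrow> complex" where
  "zLn s = (\<lambda>w. w * Ln (1 - s * w))"

lemma zLn_holomorphic:
  assumes "cmod s < 1"
  obtains R where "1 < R" "zLn s holomorphic_on cball 0 R"
proof
  \<comment> \<open>Chosen so that \<open>cmod s * ?R < 1 < ?R\<close>, including the case
    \<open>s = 0\<close>.\<close>
  let ?R = "2 / (1 + cmod s)"
  have pos: "0 < 1 + cmod s"
    using norm_ge_zero[of s] by linarith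
  show "1 < ?R"
    using assms pos by simp
  have "cmod (s * w) < 1" if "w \<in> cball 0 ?R" for w
  proof -
    have "cmod (s * w) \<le> cmod s * ?R"
      using that by (simp add: norm_mult mult_left_mono del: times_divide_eq_right)
    also have "\<dots> < 1"
      using assms pos by (simp add: field_simps)
    finally show ?thesis .
  qed
  then show "zLn s holomorphic_on cball 0 ?R"
    unfolding zLn_def
    by (intro holomorphic_intros) (auto dest: one_minus_notin_nonpos_Reals)
qed

lemma zLn_St2: "cmod s < 1 \<Longrightarrow> zLn s \<in> St2"
  by (metis zLn_holomorphic holomorphic_cball_imp_St2)

text \<open>Division by zero makes the formula give the correct value 0 for n = 0 and n = 1.\<close>
lemma tcoeff_zLn:
  assumes "cmod s < 1"
  shows "tcoeff (zLn s) = (\<lambda>n. - (s ^ (n - 1)) / of_nat (n - 1))"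
proof (rule tcoeff_unique(1))
  fix z :: complex assume z: "cmod z < 1"
  have "cmod (s * z) < 1"
    using assms z by (rule cmod_mult_less_1)
  from sums_mult[OF Ln_one_minus_sums[OF this], of z]
  have "(\<lambda>n. - (s ^ (Suc n - 1)) / of_nat (Suc n - 1) * z ^ Suc n) sums zLn s z"
    by (simp add: zLn_def power_mult_distrib ac_simps)
  from sums_Suc[OF this] show "(\<lambda>n. - (s ^ (n - 1)) / of_nat (n - 1) * z ^ n) sums zLn s z"
    by simp
qed

lemma tcoeff_ident: "tcoeff (\<lambda>w. w) = (\<lambda>n. if n = 1 then 1 else 0)"
proof (rule tcoeff_unique(1))
  fix z :: complex
  show "(\<lambda>n. (if n = 1 then 1 else 0) * z ^ n) sums z"
    using sums_single[of 1 "\<lambda>n. z ^ n"] by (simp add: if_distrib if_distribR cong: if_cong)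
qed

lemma ident_St2: "(\<lambda>w. w) \<in> St2"
  by (rule holomorphic_cball_imp_St2[of _ 2]) (auto intro: holomorphic_intros)

lemma St2_inner_ident: "St2_inner (\<lambda>w. w) f = cnj (tcoeff f 1)"
proof -
  have "(\<lambda>n. of_real (wt2 n) * tcoeff (\<lambda>w. w) n * cnj (tcoeff f n))
      = (\<lambda>n. if n = 1 then cnj (tcoeff f n) else 0)"
    by (auto simp: tcoeff_ident wt2_def)
  then show ?thesis
    using sums_single[of 1 "\<lambda>n. cnj (tcoeff f n)"] by (simp add: St2_inner_def sums_iff)
qed

text \<open>For \<open>n \<ge> 2\<close> the weight \<open>n * (n - 1)\<close> cancels the
  denominator \<open>n - 1\<close> and leaves the terms of the series of \<open>deriv f\<close>,
  negated and conjugated. The missing term of index 1 is the correction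
  \<open>cnj (tcoeff f 1)\<close>.\<close>

lemma St2_inner_zLn:
  assumes f: "f \<in> St2" and s: "cmod s < 1"
  shows "St2_inner (zLn (cnj s)) f = cnj (tcoeff f 1) - cnj (deriv f s)"
proof -
  have "deriv f holomorphic_on ball 0 1"
    using St2_holomorphic[OF f] by (intro holomorphic_deriv) auto
  from sums_tcoeff[OF this s]
  have "(\<lambda>n. of_nat (Suc n) * tcoeff f (Suc n) * s ^ (Suc n - 1)) sums deriv f s"
    by (simp add: tcoeff_deriv)
  from sums_Suc[OF this] have "(\<lambda>n. of_nat n * tcoeff f n * s ^ (n - 1)) sums deriv f s"
    by simp
  from sums_diff[OF sums_single[of 1 "\<lambda>n. cnj (tcoeff f n)"] sums_cnj[THEN iffD2, OF this]]
  have "(\<lambda>n. (if n = 1 then cnj (tcoeff f n) else 0) - cnj (of_nat n * tcoeff f n * s ^ (n - 1)))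
      sums (cnj (tcoeff f 1) - cnj (deriv f s))" .
  also have "(\<lambda>n. (if n = 1 then cnj (tcoeff f n) else 0) - cnj (of_nat n * tcoeff f n * s ^ (n - 1)))
      = (\<lambda>n. of_real (wt2 n) * tcoeff (zLn (cnj s)) n * cnj (tcoeff f n))"
  proof
    fix n
    have "n = 0 \<or> n = 1 \<or> (\<exists>k. n = Suc (Suc k))"
      by (metis One_nat_def not0_implies_Suc)
    then show "(if n = 1 then cnj (tcoeff f n) else 0) - cnj (of_nat n * tcoeff f n * s ^ (n - 1))
        = of_real (wt2 n) * tcoeff (zLn (cnj s)) n * cnj (tcoeff f n)"
      using s by (auto simp: tcoeff_zLn wt2_def field_simps of_nat_eq_0_iff simp flip: of_nat_Suc)
  qed
  finally show ?thesis
    by (simp add: St2_inner_def sums_iff)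
qed

text \<open>Both sides have the same exponential. Each of the four logarithms has imaginary part of
  modulus below \<open>pi / 2\<close>, so the imaginary parts of the two sides differ by less than
  \<open>2 * pi\<close> and no branch jump can occur.\<close>

lemma Ln_quotient_right_half_plane:
  assumes "0 < Re p" "0 < Re q" "0 < Re s" "0 < Re t" "p * t = q * s"
  shows "Ln p = Ln q + Ln s - Ln t"
proof (rule exp_complex_eqI)
  have nz: "p \<noteq> 0" "q \<noteq> 0" "s \<noteq> 0" "t \<noteq> 0"
    using assms by auto
  then show "exp (Ln p) = exp (Ln q + Ln s - Ln t)"
    using assms(5) by (simp add: exp_add exp_diff field_simps)
  show "\<bar>Im (Ln p) - Im (Ln q + Ln s - Ln t)\<bar> < 2 * pi"
    using assms(1-4)[THEN Re_Ln_pos_lt_imp] by simp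
qed

section \<open>The adjoint of \<open>Dop \<phi>\<close> and its values\<close>

context contractive_symbol
begin

text \<open>Forced by pairing with monomials, since \<open>Dop \<phi>\<close> sends
  \<open>z ^ n\<close> to \<open>n * \<phi> ^ (n - 1)\<close>. The factor \<open>real n\<close>
  kills the term where \<open>n - 1\<close> is truncated.\<close>

definition Dop_adjoint :: "(complex \<Rightarrow> complex) \<Rightarrow> complex \<Rightarrow> complex" where
  "Dop_adjoint g =
     (\<lambda>z. \<Sum>n. of_real (real n / wt2 n) * cnj (St2_inner (\<lambda>w. \<phi> w ^ (n - 1)) g) * z ^ n)"

lemma Dop_adjoint_St2:
  assumes g: "g \<in> St2"
  shows "Dop_adjoint g \<in> St2"
    and "tcoeff (Dop_adjoint g) =
      (\<lambda>n. of_real (real n / wt2 n) * cnj (St2_inner (\<lambda>w. \<phi> w ^ (n - 1)) g))"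
proof -
  define C where "C = (\<Sum>k. wt2 k * (1 / R) ^ k) * St2_norm g"
  have C: "cmod (St2_inner (\<lambda>w. \<phi> w ^ m) g) \<le> r ^ m * C" for m
    using St2_inner_bound[OF power_tcoeff_bound _ _ g, of m] R by (simp add: C_def mult.assoc)
  \<comment> \<open>The division by \<open>r\<close> compensates for the exponent
    \<open>n - 1\<close>.\<close>
  have "cmod (of_real (real n / wt2 n) * cnj (St2_inner (\<lambda>w. \<phi> w ^ (n - 1)) g)) \<le> (C / r) * r ^ n" for n
  proof (cases n)
    case 0
    then show ?thesis
      using order_trans[OF norm_ge_zero C[of 0]] r by simp
  next
    case (Suc m)
    have "real n / wt2 n \<le> 1"
      using Suc by (auto simp: wt2_def)
    then have "(real n / wt2 n) * cmod (St2_inner (\<lambda>w. \<phi> w ^ m) g) \<le> 1 * (r ^ m * C)"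
      by (intro mult_mono C) auto
    then show ?thesis
      using Suc r by (simp add: norm_mult norm_divide ac_simps del: of_nat_Suc)
  qed
  from St2_power_series[OF summable_wt2_decay[OF this]]
  show "Dop_adjoint g \<in> St2" and "tcoeff (Dop_adjoint g) =
      (\<lambda>n. of_real (real n / wt2 n) * cnj (St2_inner (\<lambda>w. \<phi> w ^ (n - 1)) g))"
    using r by (simp_all add: Dop_adjoint_def)
qed

lemma is_adjoint_Dop: "is_adjoint (Dop \<phi>) Dop_adjoint"
  unfolding is_adjoint_def
proof (intro conjI ballI)
  fix f g assume f: "f \<in> St2" and g: "g \<in> St2"
  have "deriv f holomorphic_on ball 0 1"
    using St2_holomorphic[OF f] by (intro holomorphic_deriv) auto
  from inner_comp_sums[OF this g]
  have "(\<lambda>m. of_real (wt2 (Suc m)) * tcoeff f (Suc m) * cnj (tcoeff (Dop_adjoint g) (Suc m)))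
      sums St2_inner (Dop \<phi> f) g"
    by (simp add: Dop_def tcoeff_deriv Dop_adjoint_St2(2)[OF g] ac_simps)
  from sums_Suc[OF this] show "St2_inner (Dop \<phi> f) g = St2_inner f (Dop_adjoint g)"
    by (simp add: St2_inner_def[of f] sums_iff Dop_adjoint_St2(2)[OF g])
qed (rule Dop_adjoint_St2(1))

text \<open>Evaluation at \<open>\<zeta>\<close> is the pairing with \<open>D\<^sub>\<phi> K\<^sub>\<zeta>\<close>, where \<open>K\<^sub>\<zeta>\<close> is the reproducing kernel.\<close>
lemma Dop_adjoint_eval:
  assumes g: "g \<in> St2" and \<zeta>: "cmod \<zeta> < 1"
  shows "Dop_adjoint g \<zeta> = \<zeta> * cnj (St2_inner (\<lambda>w. 1 - Ln (1 - cnj \<zeta> * \<phi> w)) g)"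
proof -
  let ?F = "\<lambda>u. 1 - Ln (1 - cnj \<zeta> * u)"
  \<comment> \<open>The logarithmic series contributes 0 at \<open>m = 0\<close> through division by
    zero, so the constant 1 alone gives that coefficient.\<close>
  have "(\<lambda>m. (if m = 0 then 1 else cnj \<zeta> ^ m / of_nat m) * u ^ m) sums ?F u" if "cmod u < 1" for u
  proof -
    have "cmod (cnj \<zeta> * u) < 1"
      using \<zeta> that by (simp add: cmod_mult_less_1)
    from sums_diff[OF sums_single[of 0 "\<lambda>_. 1"] Ln_one_minus_sums[OF this]] show ?thesis
      by (rule back_subst[where P = "\<lambda>h. h sums _"]) (auto simp: fun_eq_iff power_mult_distrib)
  qed
  note F = tcoeff_unique[OF this]
  have "(\<lambda>m. tcoeff (Dop_adjoint g) (Suc m) * \<zeta> ^ Suc m)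
      sums (\<zeta> * cnj (St2_inner (\<lambda>w. ?F (\<phi> w)) g))"
  proof (rule back_subst[where P = "\<lambda>h. h sums _"])
    show "(\<lambda>m. \<zeta> * cnj (tcoeff ?F m * St2_inner (\<lambda>w. \<phi> w ^ m) g)) sums
        (\<zeta> * cnj (St2_inner (\<lambda>w. ?F (\<phi> w)) g))"
      by (intro sums_mult sums_cnj[THEN iffD2] inner_comp_sums F g)
    \<comment> \<open>The factor \<open>(m + 1) / wt2 (m + 1)\<close> equals \<open>1 / m\<close>
      for \<open>m > 0\<close> and 1 for \<open>m = 0\<close>, matching the coefficients of
      \<open>?F\<close>.\<close>
    have coeff: "of_real (real (Suc m) / wt2 (Suc m)) * \<zeta> ^ m = cnj (tcoeff ?F m)" for m
    proof (cases "m = 0")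
      case False
      then have "real (Suc m) / wt2 (Suc m) = 1 / real m"
        by (simp add: wt2_def)
      then show ?thesis
        using False by (simp add: F)
    qed (simp add: F wt2_def)
    show "(\<lambda>m. \<zeta> * cnj (tcoeff ?F m * St2_inner (\<lambda>w. \<phi> w ^ m) g))
        = (\<lambda>m. tcoeff (Dop_adjoint g) (Suc m) * \<zeta> ^ Suc m)"
      unfolding complex_cnj_mult coeff[symmetric] Dop_adjoint_St2(2)[OF g] by (simp add: ac_simps)
  qed
  from sums_Suc[OF this] have "(\<lambda>n. tcoeff (Dop_adjoint g) n * \<zeta> ^ n) sums
      (\<zeta> * cnj (St2_inner (\<lambda>w. ?F (\<phi> w)) g))"
    by (simp add: Dop_adjoint_St2(2)[OF g])
  then show ?thesis
    using sums_tcoeff[OF St2_holomorphic[OF Dop_adjoint_St2(1)[OF g]] \<zeta>] sums_unique2 by blast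
qed

end

section \<open>Extension of the linear fractional map beyond the closed disk\<close>

text \<open>Cleared of its denominator, the bound by the supremum is a closed condition and passes
  to the closed disk. There a pole would be a common zero of numerator and denominator, against
  \<open>nondeg\<close>. With a slightly larger bound the condition becomes strict and open, and
  compactness provides a larger disk.\<close>

lemma moebius_contractive:
  fixes a b c d :: complex
  defines "\<phi> \<equiv> (\<lambda>z. (a * z + b) / (c * z + d))"
  assumes nondeg: "a * d - b * c \<noteq> 0"
    and nopole: "\<forall>z\<in>ball 0 1. c * z + d \<noteq> 0"
    and self_map: "\<forall>z\<in>ball 0 1. \<phi> z \<in> ball 0 1"
    and sup_lt1: "(SUP z\<in>ball 0 1. cmod (\<phi> z)) < 1"
  obtains R r where "contractive_symbol \<phi> R r" "\<And>z. cmod z \<le> R \<Longrightarrow> c * z + d \<noteq> 0"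
proof -
  define q where "q = (SUP z\<in>ball 0 1. cmod (\<phi> z))"
  \<comment> \<open>Strictly between \<open>q\<close> and 1, and positive even when
    \<open>q = 0\<close>.\<close>
  define r where "r = (1 + q) / 2"
  have le: "cmod (\<phi> z) \<le> q" if "z \<in> ball 0 1" for z
    unfolding q_def using self_map that
    by (intro cSUP_upper bdd_aboveI2[of _ _ 1]) (auto intro: less_imp_le)
  have q: "0 \<le> q" "q < 1"
    using le[of 0] norm_ge_zero[of "\<phi> 0"] sup_lt1 by (auto simp: q_def[symmetric] simp del: norm_ge_zero)
  then have r: "0 < r" "q < r" "r < 1"
    by (simp_all add: r_def)
  have "closure (ball 0 1) \<subseteq> {z. cmod (a * z + b) \<le> q * cmod (c * z + d)}"
  proof (rule closure_minimal)
    show "ball 0 1 \<subseteq> {z. cmod (a * z + b) \<le> q * cmod (c * z + d)}"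
      using le nopole by (fastforce simp: \<phi>_def norm_divide divide_le_eq)
    show "closed {z. cmod (a * z + b) \<le> q * cmod (c * z + d)}"
      by (intro closed_Collect_le continuous_intros)
  qed
  then have cl: "cmod (a * z + b) \<le> q * cmod (c * z + d)" if "cmod z \<le> 1" for z
    using that by auto
  have nz: "c * z + d \<noteq> 0" if "cmod z \<le> 1" for z
  proof
    assume z: "c * z + d = 0"
    then have "a * z + b = 0"
      using cl[OF that] by simp
    moreover have "a * d - b * c = a * (c * z + d) - c * (a * z + b)"
      by (simp add: algebra_simps)
    ultimately show False
      using nondeg z by simp
  qed
  define U where "U = {z. cmod (a * z + b) < r * cmod (c * z + d)}"
  have "open U"
    unfolding U_def by (intro open_Collect_less continuous_intros)
  moreover have "cball 0 1 \<subseteq> U"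
  proof
    fix z :: complex assume "z \<in> cball 0 1"
    then have z: "cmod z \<le> 1" by simp
    note cl[OF z]
    also have "q * cmod (c * z + d) < r * cmod (c * z + d)"
      using nz[OF z] r by simp
    finally show "z \<in> U" by (simp add: U_def)
  qed
  ultimately obtain e where e: "0 < e" "(\<Union>x\<in>cball 0 1. cball x e) \<subseteq> U"
    using compact_subset_open_imp_cball_epsilon_subset[OF compact_cball] by blast
  have U: "z \<in> U" if "cmod z \<le> 1 + e" for z
  proof -
    \<comment> \<open>Radial contraction into the closed unit disk moves \<open>z\<close> by at most
      \<open>e\<close>.\<close>
    define x where "x = z / of_real (1 + e)"
    have x: "z = of_real (1 + e) * x"
      using e by (simp add: x_def del: of_real_add)
    have "cmod x \<le> 1"
      using that e by (simp add: x_def norm_divide del: of_real_add)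
    moreover have "z - x = of_real e * x"
      by (subst x) (simp add: algebra_simps)
    ultimately have "z \<in> cball x e"
      using e by (simp add: dist_norm norm_minus_commute[of x] norm_mult mult_left_le)
    then show ?thesis
      using e \<open>cmod x \<le> 1\<close> by force
  qed
  have pole: "c * z + d \<noteq> 0" if "cmod z \<le> 1 + e" for z
    using U[OF that] by (auto simp: U_def)
  have "contractive_symbol \<phi> (1 + e) r"
  proof
    show "\<phi> holomorphic_on cball 0 (1 + e)"
      unfolding \<phi>_def using pole by (intro holomorphic_intros) auto
    show "cmod (\<phi> z) \<le> r" if "cmod z \<le> 1 + e" for z
      using U[OF that] pole[OF that] by (simp add: \<phi>_def U_def norm_divide divide_le_eq)
  qed (use e r in auto)
  with pole that show thesis by blast
qed

section \<open>Splitting of the logarithm and the finite rank remainder\<close>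

theorem theorem6p5:
  fixes a b c d :: complex
  defines "\<phi> \<equiv> (\<lambda>z. (a * z + b) / (c * z + d))"
      and "\<sigma> \<equiv> (\<lambda>z. (cnj a * z - cnj c) / (- cnj b * z + cnj d))"
  assumes nondeg: "a * d - b * c \<noteq> 0"
      and nopole: "\<forall>z\<in>ball 0 1. c * z + d \<noteq> 0"
      and self_map: "\<forall>z\<in>ball 0 1. \<phi> z \<in> ball 0 1"
      and sup_lt1: "(SUP z\<in>ball 0 1. cmod (\<phi> z)) < 1"
  shows "\<exists>K1 Dphi_adj Tz_adj.
           is_adjoint (Dop \<phi>) Dphi_adj \<and> is_adjoint Tz Tz_adj \<and> finite_rank_op K1 \<and>
           (\<forall>f\<in>St2. disk_eq (Dphi_adj (Tz_adj f)) (\<lambda>z. Tz (Dop \<sigma> f) z + K1 f z))"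
proof -
  obtain R r where sym: "contractive_symbol \<phi> R r"
    and pole: "\<And>z. cmod z \<le> R \<Longrightarrow> c * z + d \<noteq> 0"
    using moebius_contractive[OF nondeg nopole self_map[unfolded \<phi>_def] sup_lt1[unfolded \<phi>_def]]
    unfolding \<phi>_def by blast
  interpret contractive_symbol \<phi> R r by (rule sym)
  have d: "d \<noteq> 0"
    using pole[of 0] R by simp
  \<comment> \<open>Otherwise the pole \<open>- d / c\<close> would lie in the closed unit
    disk.\<close>
  have cd: "cmod (- c / d) < 1"
  proof (rule ccontr)
    assume "\<not> cmod (- c / d) < 1"
    then have "cmod (- d / c) \<le> 1" and "c \<noteq> 0"
      using d by (auto simp: norm_divide divide_simps split: if_splits)
    then show False
      using pole[of "- d / c"] R by simp
  qed
  \<comment> \<open>The quotient is the value of \<phi> at 0.\<close>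
  have bd: "cmod (b / d) < 1"
    using self_map by (auto simp: \<phi>_def dest: bspec[of _ _ 0])
  \<comment> \<open>One summand for each separated logarithm: \<open>- Ln (1 + (c/d) w)\<close>
    gives a functional times the identity, and the constant \<Lambda> below gives a multiple of
    \<open>tcoeff f 1\<close> times \<open>zLn (cnj (b / d))\<close>.\<close>
  define K where "K = (\<lambda>f z. cnj (St2_inner (zLn (- c / d)) f) * z + (- tcoeff f 1) * zLn (cnj (b / d)) z)"
  obtain R' where R': "1 < R'" "zLn (- c / d) holomorphic_on cball 0 R'"
    using zLn_holomorphic[OF cd] by blast
  obtain B where B: "\<And>n. cmod (tcoeff (zLn (- c / d)) n) \<le> B * (1 / R') ^ n"
    using holomorphic_cball_imp_tcoeff_decay[OF R'(2,1)] by blast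
  have "finite_rank_op K"
    unfolding K_def
  proof (rule finite_rank_op_rank_2)
    show "(\<lambda>z. z) \<in> St2" "zLn (cnj (b / d)) \<in> St2"
      using bd by (intro ident_St2 zLn_St2; simp add: norm_divide)+
    fix f assume f: "f \<in> St2"
    show "cmod (- tcoeff f 1) \<le> 1 * St2_norm f"
      using St2_tcoeff_le_norm[OF f] by simp
    fix g c' assume g: "g \<in> St2"
    show "- tcoeff (\<lambda>z. c' * f z + g z) 1 = c' * (- tcoeff f 1) + - tcoeff g 1"
      using tcoeff_linear[OF f[THEN St2_holomorphic] g[THEN St2_holomorphic]] by simp
    \<comment> \<open>Conjugation moves the argument to the first slot, where the inner product is
      linear.\<close>
    show "cnj (St2_inner (zLn (- c / d)) (\<lambda>z. c' * f z + g z)) =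
        c' * cnj (St2_inner (zLn (- c / d)) f) + cnj (St2_inner (zLn (- c / d)) g)"
      using f g zLn_St2[OF cd] by (simp add: St2_inner_cnj St2_linear St2_inner_linear_left)
  next
    show "cmod (cnj (St2_inner (zLn (- c / d)) f)) \<le> (B * (\<Sum>k. wt2 k * (1 / R') ^ k)) * St2_norm f"
      if "f \<in> St2" for f
      using St2_inner_bound[OF B _ _ that] R' by simp
  qed
  moreover have "Dop_adjoint (Tz_adjoint f) \<zeta> = Tz (Dop \<sigma> f) \<zeta> + K f \<zeta>"
    if f: "f \<in> St2" and \<zeta>: "cmod \<zeta> < 1" for f \<zeta>
  proof -
    have b\<zeta>: "cmod (b / d * cnj \<zeta>) < 1"
      using bd \<zeta> by (intro cmod_mult_less_1) auto
    have den: "d - b * cnj \<zeta> \<noteq> 0"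
    proof
      assume "d - b * cnj \<zeta> = 0"
      then have "b / d * cnj \<zeta> = 1"
        using d by (simp add: field_simps)
      with b\<zeta> show False by (metis norm_one less_irrefl)
    qed
    have cnj_\<sigma>: "(d - b * cnj \<zeta>) * cnj (\<sigma> \<zeta>) = a * cnj \<zeta> - c"
      using den by (simp add: \<sigma>_def)
    have prod: "(c * w + d) * (1 - cnj \<zeta> * \<phi> w) = (d - b * cnj \<zeta>) * (1 - cnj (\<sigma> \<zeta>) * w)"
      if "cmod w \<le> R" for w
    proof -
      have "(c * w + d) * \<phi> w = a * w + b"
        using pole[OF that] by (simp add: \<phi>_def)
      then have "(c * w + d) * (1 - cnj \<zeta> * \<phi> w) = (c * w + d) - cnj \<zeta> * (a * w + b)"
        by (metis mult.left_commute mult.right_neutral right_diff_distrib)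
      also have "\<dots> = (d - b * cnj \<zeta>) - (a * cnj \<zeta> - c) * w"
        by (simp add: algebra_simps)
      also have "\<dots> = (d - b * cnj \<zeta>) * (1 - cnj (\<sigma> \<zeta>) * w)"
        by (simp only: right_diff_distrib mult_1_right flip: cnj_\<sigma> mult.assoc)
      finally show ?thesis .
    qed
    have \<phi>_lt: "cmod (cnj \<zeta> * \<phi> w) < 1" if "cmod w \<le> R" for w
      using bound[OF that] r \<zeta> by (intro cmod_mult_less_1) auto
    have \<sigma>_lt: "cmod (\<sigma> \<zeta>) < 1"
    proof (rule ccontr)
      assume ge: "\<not> cmod (\<sigma> \<zeta>) < 1"
      \<comment> \<open>A zero of the right side of \<open>prod\<close> that would lie in the closed
        unit disk, where both factors on the left are nonzero.\<close>
      define w where "w = 1 / cnj (\<sigma> \<zeta>)"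
      have w: "cmod w \<le> R" "cnj (\<sigma> \<zeta>) * w = 1"
        using ge R order_trans[of "cmod w" 1 R] by (auto simp: w_def norm_divide divide_le_eq)
      then have "1 - cnj \<zeta> * \<phi> w = 0"
        using prod[OF w(1)] pole[OF w(1)] by auto
      then show False
        using \<phi>_lt[OF w(1)] by (metis eq_iff_diff_eq_0 norm_one less_irrefl)
    qed
    define \<Lambda> where "\<Lambda> = Ln (1 - b / d * cnj \<zeta>)"
    have Ln_split: "Ln (1 - cnj \<zeta> * \<phi> w) = Ln (1 - cnj (\<sigma> \<zeta>) * w) + \<Lambda> - Ln (1 - (- c / d) * w)"
      if w: "cmod w < 1" for w
      unfolding \<Lambda>_def
    proof (rule Ln_quotient_right_half_plane)
      have lt: "cmod (s * w) < 1" if "cmod s < 1" for s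
        using that w by (rule cmod_mult_less_1)
      show "0 < Re (1 - cnj \<zeta> * \<phi> w)" "0 < Re (1 - cnj (\<sigma> \<zeta>) * w)"
        by (rule Re_one_minus_pos, use \<phi>_lt[of w] w R lt[of "cnj (\<sigma> \<zeta>)"] \<sigma>_lt in simp)+
      show "0 < Re (1 - b / d * cnj \<zeta>)" "0 < Re (1 - (- c / d) * w)"
        by (rule Re_one_minus_pos, fact b\<zeta> lt[OF cd])+
      have "(1 - cnj \<zeta> * \<phi> w) * (1 - (- c / d) * w) = (c * w + d) * (1 - cnj \<zeta> * \<phi> w) / d"
        using d by (simp add: field_simps)
      also have "\<dots> = (d - b * cnj \<zeta>) * (1 - cnj (\<sigma> \<zeta>) * w) / d"
        using prod[of w] w R by simp
      also have "\<dots> = (1 - cnj (\<sigma> \<zeta>) * w) * (1 - b / d * cnj \<zeta>)"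
        using d by (simp add: field_simps)
      finally show "(1 - cnj \<zeta> * \<phi> w) * (1 - (- c / d) * w)
          = (1 - cnj (\<sigma> \<zeta>) * w) * (1 - b / d * cnj \<zeta>)" .
    qed
    let ?k = "\<lambda>w. 1 - Ln (1 - cnj \<zeta> * \<phi> w)"
    let ?t = "\<lambda>w. (1 - \<Lambda>) * w + zLn (- c / d) w"
    \<comment> \<open>Nested in the shape \<open>c * f + g\<close> of \<open>St2_linear\<close> and
      \<open>St2_inner_linear_left\<close>.\<close>
    let ?h = "\<lambda>w. (- 1) * zLn (cnj (\<sigma> \<zeta>)) w + ?t w"
    have "?k holomorphic_on cball 0 R"
      using hol \<phi>_lt by (intro holomorphic_intros) (auto dest: one_minus_notin_nonpos_Reals)
    then have k: "?k \<in> St2"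
      using R by (rule holomorphic_cball_imp_St2)
    have mem: "zLn (cnj (\<sigma> \<zeta>)) \<in> St2" "zLn (- c / d) \<in> St2" "?t \<in> St2"
      using \<sigma>_lt cd by (auto intro!: zLn_St2 St2_linear ident_St2)
    \<comment> \<open>\<open>Ln_split\<close> is available only on the unit disk, so the two
      functions are compared through their coefficients, which determine the inner product.\<close>
    have "tcoeff (Tz ?k) = tcoeff ?h"
    proof (rule tcoeff_cong)
      show "?h holomorphic_on ball 0 1"
        by (rule St2_holomorphic[OF St2_linear[OF mem(1,3)]])
      show "Tz ?k w = ?h w" if "cmod w < 1" for w
        unfolding Tz_def zLn_def Ln_split[OF that] by (simp add: algebra_simps)
    qed
    then have "St2_inner (Tz ?k) f = St2_inner ?h f"
      by (simp add: St2_inner_def)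
    also have "\<dots> = - St2_inner (zLn (cnj (\<sigma> \<zeta>))) f + ((1 - \<Lambda>) * cnj (tcoeff f 1) + St2_inner (zLn (- c / d)) f)"
      using mem f ident_St2 by (simp only: St2_inner_linear_left St2_inner_ident) simp
    also have "\<dots> = cnj (deriv f (\<sigma> \<zeta>)) - \<Lambda> * cnj (tcoeff f 1) + St2_inner (zLn (- c / d)) f"
      by (simp add: St2_inner_zLn[OF f \<sigma>_lt] algebra_simps)
    finally have inner: "St2_inner (Tz ?k) f =
        cnj (deriv f (\<sigma> \<zeta>)) - \<Lambda> * cnj (tcoeff f 1) + St2_inner (zLn (- c / d)) f" .
    have cnj_\<Lambda>: "cnj \<Lambda> = Ln (1 - cnj (b / d) * \<zeta>)"
      unfolding \<Lambda>_def by (subst cnj_Ln[OF one_minus_notin_nonpos_Reals[OF b\<zeta>]]) simp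
    have "Dop_adjoint (Tz_adjoint f) \<zeta> = \<zeta> * cnj (St2_inner ?k (Tz_adjoint f))"
      by (rule Dop_adjoint_eval[OF Tz_adjoint_St2(1)[OF f] \<zeta>])
    also have "St2_inner ?k (Tz_adjoint f) = St2_inner (Tz ?k) f"
      using is_adjoint_Tz k f by (simp add: is_adjoint_def)
    finally show ?thesis
      unfolding inner by (simp add: cnj_\<Lambda> Tz_def Dop_def K_def zLn_def algebra_simps)
  qed
  ultimately show ?thesis
    using is_adjoint_Dop is_adjoint_Tz
    by (intro exI[of _ K] exI[of _ Dop_adjoint] exI[of _ Tz_adjoint]) (auto simp: disk_eq_def)
qed

end
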